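(* Let $A^F\in\mathbb{R}^{m_F\times n}$, $b^F\in\mathbb{R}^{m_F}$, $c^F\in\mathbb{R}^n$, and let $\mathcal{D}^F=(\mathcal{N},\mathcal{A},\nu,l)$ be a decision diagram encoding the feasible set $\mathcal{X}=\{x\in\{0,1\}^n: A^F x\le b^F\}$ with objective $f(x)=\sum_{j=1}^n c^F_j x_j$, with arc lengths $l_a=c^F_{\tau_a}$ if $\nu_a=1$ and $l_a=0$ otherwise. Let $x^L\in\{0,1\}^n$ be any feasible leader's solution of the two-stage program (DTS) described in the context. Then there exists a one-to-one mapping between follower's solutions $x^F$ satisfying $$x^F\in\arg\max_{\overline{x}^F}\Big\{\sum_{j=1}^n c^F_j\overline{x}^F_j \;:\; A^F\overline{x}^F\le b^F,\ \overline{x}^F\le \mathbf{1}-x^L,\ \overline{x}^F\in\{0,1\}^n\Big\}$$ and optimal solutions of the constrained path problem over $\mathcal{D}^F$ with a maximization objective sense and $m\le|\mathcal{A}|$ side constraints $$\max_{y\in\{0,1\}^{|\mathcal{A}|}}\Big\{\sum_{a\in\mathcal{A}} l_a y_a \;:\; \{a\in\mathcal{A}:y_a=1\}\text{ is an }\mathbf{r}\text{-}\mathbf{t}\text{ path in }\mathcal{D}^F,\;\; y_a\le 1-x^L_{\tau_a}\ \ \forall a\in\mathcal{A}\text{ with }\nu_a=1\Big\}.$$ (That is, writing the side constraints as $Gy\le d$, the columns of $G$ associated with arcs $a$ with $\nu_a=1$ form an identity matrix and the remaining columns are zero vectors, with $d_a=1-x^L_{\tau_a}$ if $\nu_a=1$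 and $d_a=0$ otherwise.)
   Context: A decision diagram $\mathcal{D}=(\mathcal{N},\mathcal{A},\nu,l)$ with $n\ge 1$ variables is a finite acyclic directed (multi)graph (parallel arcs allowed) with node set partitioned into layers $\mathcal{N}_1,\dots,\mathcal{N}_{n+1}$, $\mathcal{N}_1=\{\mathbf{r}\}$, $\mathcal{N}_{n+1}=\{\mathbf{t}\}$. Each arc $a$ goes from a tail in some layer $\mathcal{N}_j$ to a head in $\mathcal{N}_{j+1}$; $\tau_a:=j$ is the index of the layer of its tail. Arc $a$ has a value $\nu_a\in\mathbb{Z}$ and a length $l_a\in\mathbb{R}$. The diagram encodes a finite set $\mathcal{X}\subseteq\mathbb{Z}^n$ with objective $f$ if $(a_1,\dots,a_n)\mapsto(\nu_{a_1},\dots,\nu_{a_n})$ is a one-to-one correspondence between $\mathbf{r}$-$\mathbf{t}$ paths and $\mathcal{X}$, and the length $\sum_j l_{a_j}$ of each path equals $f$ of its solution. The two-stage (leader-follower) program (DTS) is $$\max_{x^L,x^F}\ \sum_{j=1}^n(c^L_{1j}x^L_j+c^L_{2j}x^F_j)\ \text{ s.t. } A^Lx^L+B^Lx^F\le b^L,\ \ x^F\in\arg\max_{\overline{x}^F\in\{0,1\}^n}\{c^F\overline{x}^F: A^F\overline{x}^F\le b^F,\ \overline{x}^F\le\mathbf{1}-x^L\},\ \ x^L\in\{0,1\}^n,$$ with real data. It is assumed that for any feasible leader solution there is a feasible follower response (relatively complete recourse). *)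

theory Defs
  imports
    "HOL-Library.FuncSet"
    "Graph_Theory.Arc_Walk"
    "Jordan_Normal_Form.Matrix"
begin

section \<open>Decision diagrams\<close>

text \<open>
  The underlying multigraph is a \<^typ>\<open>('v, 'a) pre_digraph\<close>, so parallel arcs are allowed.
  The partition of the nodes into layers is the level map \<open>layer\<close>, whose fibre over \<open>j\<close> is the
  \<open>j\<close>-th layer.
\<close>

record ('v, 'a) dd =
  dgraph :: "('v, 'a) pre_digraph"
  layer :: "'v \<Rightarrow> nat"
  root :: 'v
  terminal :: 'v
  val :: "'a \<Rightarrow> int"
  len :: "'a \<Rightarrow> real"

text \<open>No separate acyclicity axiom is needed: every arc increases the layer by one.\<close>

locale decision_diagram =
  fixes n :: nat and D :: "('v, 'a) dd"
  assumes n_pos: "1 \<le> n"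
    and fin_digraph: "fin_digraph (dgraph D)"
    and layer_range: "\<And>v. v \<in> verts (dgraph D) \<Longrightarrow> layer D v \<in> {1..n + 1}"
    and first_layer: "{v \<in> verts (dgraph D). layer D v = 1} = {root D}"
    and last_layer: "{v \<in> verts (dgraph D). layer D v = n + 1} = {terminal D}"
    and arc_layer: "\<And>a. a \<in> arcs (dgraph D) \<Longrightarrow>
      layer D (head (dgraph D) a) = layer D (tail (dgraph D) a) + 1"

definition tail_layer :: "('v, 'a) dd \<Rightarrow> 'a \<Rightarrow> nat" where
  "tail_layer D a = layer D (tail (dgraph D) a)"

definition rt_path :: "('v, 'a) dd \<Rightarrow> 'a list \<Rightarrow> bool" where
  "rt_path D p \<longleftrightarrow> pre_digraph.apath (dgraph D) (root D) p (terminal D)"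

definition path_solution :: "('v, 'a) dd \<Rightarrow> 'a list \<Rightarrow> int vec" where
  "path_solution D p = vec_of_list (map (val D) p)"

definition encodes :: "('v, 'a) dd \<Rightarrow> int vec set \<Rightarrow> (int vec \<Rightarrow> real) \<Rightarrow> bool" where
  "encodes D X f \<longleftrightarrow>
     bij_betw (path_solution D) {p. rt_path D p} X \<and>
     (\<forall>p. rt_path D p \<longrightarrow> (\<Sum>a\<leftarrow>p. len D a) = f (path_solution D p))"


section \<open>The two-stage program\<close>

text \<open>
  Vectors are indexed from 0, layers from 1: the variable with index \<open>j\<close> in \<open>{1..n}\<close> is the
  component \<open>j - 1\<close>.
\<close>

definition binary_vecs :: "nat \<Rightarrow> int vec set" where
  "binary_vecs n = {x \<in> carrier_vec n. \<forall>j<n. x $ j \<in> {0, 1}}"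

abbreviation rvec :: "int vec \<Rightarrow> real vec" where
  "rvec \<equiv> map_vec real_of_int"

definition feasible_set :: "nat \<Rightarrow> real mat \<Rightarrow> real vec \<Rightarrow> int vec set" where
  "feasible_set n A b = {x \<in> binary_vecs n. A *\<^sub>v rvec x \<le> b}"

definition follower_feasible :: "nat \<Rightarrow> real mat \<Rightarrow> real vec \<Rightarrow> int vec \<Rightarrow> int vec \<Rightarrow> bool" where
  "follower_feasible n AF bF xL x \<longleftrightarrow>
     x \<in> binary_vecs n \<and> AF *\<^sub>v rvec x \<le> bF \<and> x \<le> vec n (\<lambda>_. 1) - xL"

definition follower_optimal ::
  "nat \<Rightarrow> real mat \<Rightarrow> real vec \<Rightarrow> real vec \<Rightarrow> int vec \<Rightarrow> int vec \<Rightarrow> bool" where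
  "follower_optimal n AF bF cF xL xF \<longleftrightarrow>
     is_arg_max (\<lambda>x. cF \<bullet> rvec x) (follower_feasible n AF bF xL) xF"

text \<open>
  A leader decision is feasible if it is compatible with the leader's constraints for some binary
  \<open>xF\<close>.  The follower's problem is deliberately left out: the existence of a follower response is
  the content of relatively complete recourse.  Every \<open>xL\<close> that belongs to a feasible pair of the
  two-stage program is feasible in this sense.
\<close>

definition leader_feasible ::
  "nat \<Rightarrow> real mat \<Rightarrow> real mat \<Rightarrow> real vec \<Rightarrow> int vec \<Rightarrow> bool" where
  "leader_feasible n AL BL bL xL \<longleftrightarrow>
     xL \<in> binary_vecs n \<and> (\<exists>xF \<in> binary_vecs n. AL *\<^sub>v rvec xL + BL *\<^sub>v rvec xF \<le> bL)"

definition relatively_complete_recourse ::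
  "nat \<Rightarrow> real mat \<Rightarrow> real mat \<Rightarrow> real vec \<Rightarrow> real mat \<Rightarrow> real vec \<Rightarrow> bool" where
  "relatively_complete_recourse n AL BL bL AF bF \<longleftrightarrow>
     (\<forall>xL. leader_feasible n AL BL bL xL \<longrightarrow> (\<exists>x. follower_feasible n AF bF xL x))"


section \<open>Constrained path problems\<close>

text \<open>
  Elements of \<open>{0,1}\<close> to the power of the arc set are extensional functions, so that distinct
  functions are distinct vectors.
\<close>

definition path_vectors :: "('v, 'a) dd \<Rightarrow> ('a \<Rightarrow> real) set" where
  "path_vectors D = {y \<in> arcs (dgraph D) \<rightarrow>\<^sub>E {0, 1}.
     \<exists>p. rt_path D p \<and> set p = {a \<in> arcs (dgraph D). y a = 1}}"

text \<open>Side constraints \<open>G y \<le> d\<close> with one row for each element of \<open>R\<close>.\<close>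

definition constrained_paths ::
  "('v, 'a) dd \<Rightarrow> 'r set \<Rightarrow> ('r \<Rightarrow> 'a \<Rightarrow> real) \<Rightarrow> ('r \<Rightarrow> real) \<Rightarrow> ('a \<Rightarrow> real) set" where
  "constrained_paths D R G d =
     {y \<in> path_vectors D. \<forall>i\<in>R. (\<Sum>a\<in>arcs (dgraph D). G i a * y a) \<le> d i}"

definition interdicted_paths :: "('v, 'a) dd \<Rightarrow> int vec \<Rightarrow> ('a \<Rightarrow> real) set" where
  "interdicted_paths D xL =
     {y \<in> path_vectors D. \<forall>a\<in>arcs (dgraph D).
        val D a = 1 \<longrightarrow> y a \<le> 1 - real_of_int (xL $ (tail_layer D a - 1))}"

definition side_matrix :: "('v, 'a) dd \<Rightarrow> 'a \<Rightarrow> 'a \<Rightarrow> real" where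
  "side_matrix D i a = (if i = a \<and> val D a = 1 then 1 else 0)"

definition side_rhs :: "('v, 'a) dd \<Rightarrow> int vec \<Rightarrow> 'a \<Rightarrow> real" where
  "side_rhs D xL a = (if val D a = 1 then 1 - real_of_int (xL $ (tail_layer D a - 1)) else 0)"

definition optimal_paths :: "('v, 'a) dd \<Rightarrow> ('a \<Rightarrow> real) set \<Rightarrow> ('a \<Rightarrow> real) set" where
  "optimal_paths D Y =
     {y. is_arg_max (\<lambda>y. \<Sum>a\<in>arcs (dgraph D). len D a * y a) (\<lambda>y. y \<in> Y) y}"

end

theory Submission
  imports Defs
begin

text \<open>
  Both problems are the same problem, posed over the set of \<open>r\<close>-\<open>t\<close> paths.  An arc advances the
  layer by one, so an \<open>r\<close>-\<open>t\<close> path has exactly \<open>n\<close> arcs and its \<open>j\<close>-th arc is its only arc that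
  leaves layer \<open>j\<close> (lemmas \<open>rt_path_length\<close> and \<open>rt_path_tail_layer\<close>).  Two things follow.

  First, a path can be recovered from its set of arcs by sorting them by layer, so that paths and
  their incidence vectors correspond one to one (\<open>bij_betw_incidence\<close>); the objective of the path
  problem at an incidence vector is the length of the path.  Paths and feasible solutions of
  the follower correspond one to one, with the same objective, because the diagram encodes them.

  Secondly, the \<open>j\<close>-th variable of a solution is read off the arc in layer \<open>j\<close>.  The bound
  \<open>y\<^sub>a \<le> 1 - x\<^sup>L\<^sub>j\<close> on an arc of value 1 that leaves layer \<open>j\<close> forbids this arc exactly when the leader
  has set \<open>x\<^sup>L\<^sub>j = 1\<close>.  Hence the side constraints and the follower's constraint
  \<open>x \<le> 1 - x\<^sup>L\<close> cut out the same paths, the \<open>admissible\<close> ones (\<open>interdicted_incidence_iff\<close>,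
  \<open>follower_feasible_path_solution_iff\<close>).

  Restricted to the longest admissible paths, the two correspondences have as images the optimal
  solutions of the follower and of the path problem (\<open>bij_betw_arg_max\<close>).  The mapping
  is the inverse of the first followed by the second.
\<close>

section \<open>Transport of maximizers\<close>

lemma bij_betw_restrict:
  assumes "bij_betw h A B" and "\<And>x. x \<in> A \<Longrightarrow> h x \<in> B' \<longleftrightarrow> x \<in> A'" and "A' \<subseteq> A" and "B' \<subseteq> B"
  shows "bij_betw h A' B'"
  using assms unfolding bij_betw_def by (blast intro: inj_on_subset)

lemma bij_betw_arg_max:
  fixes f :: "'x \<Rightarrow> 'c::linorder"
  assumes bij: "bij_betw h A B" and f: "\<And>x. x \<in> A \<Longrightarrow> g (h x) = f x"
  shows "bij_betw h {x. is_arg_max f (\<lambda>x. x \<in> A) x} {y. is_arg_max g (\<lambda>y. y \<in> B) y}"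
proof (rule bij_betw_restrict[OF bij])
  fix x assume "x \<in> A"
  moreover have "B = h ` A" using bij by (simp add: bij_betw_def)
  ultimately show "h x \<in> {y. is_arg_max g (\<lambda>y. y \<in> B) y} \<longleftrightarrow>
      x \<in> {x. is_arg_max f (\<lambda>x. x \<in> A) x}"
    using f by (auto simp: is_arg_max_linorder)
qed (auto simp: is_arg_max_def)


section \<open>Paths and their incidence vectors\<close>

definition incidence :: "('v, 'a) dd \<Rightarrow> 'a list \<Rightarrow> 'a \<Rightarrow> real" where
  "incidence D p = (\<lambda>a\<in>arcs (dgraph D). if a \<in> set p then 1 else 0)"

definition admissible :: "('v, 'a) dd \<Rightarrow> int vec \<Rightarrow> 'a list \<Rightarrow> bool" where
  "admissible D xL p \<longleftrightarrow> rt_path D p \<and>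
     (\<forall>a\<in>set p. val D a = 1 \<longrightarrow> xL $ (tail_layer D a - 1) = 0)"

context decision_diagram
begin

interpretation G: fin_digraph "dgraph D"
  by (rule fin_digraph)

lemma awalk_layers:
  assumes "G.awalk u p v"
  shows "layer D v = layer D u + length p"
    and "i < length p \<Longrightarrow> tail_layer D (p ! i) = layer D u + i"
proof -
  have "layer D v = layer D u + length p \<and>
      (\<forall>i<length p. tail_layer D (p ! i) = layer D u + i)"
    using assms
  proof (induction p arbitrary: u)
    case Nil
    then show ?case by (simp add: G.awalk_def)
  next
    case (Cons a p)
    then have a: "a \<in> arcs (dgraph D)" "tail (dgraph D) a = u"
      and p: "G.awalk (head (dgraph D) a) p v"
      by (auto simp: G.awalk_def)
    have "layer D (head (dgraph D) a) = layer D u + 1"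
      using arc_layer a by blast
    with Cons.IH[OF p] a show ?case
      by (auto simp: tail_layer_def nth_Cons split: nat.split)
  qed
  then show "layer D v = layer D u + length p"
    and "i < length p \<Longrightarrow> tail_layer D (p ! i) = layer D u + i" by auto
qed

lemma rt_path_awalk: "rt_path D p \<Longrightarrow> G.awalk (root D) p (terminal D)"
  by (simp add: rt_path_def G.apath_def)

lemma rt_path_arcs: "rt_path D p \<Longrightarrow> set p \<subseteq> arcs (dgraph D)"
  using rt_path_awalk by (auto simp: G.awalk_def)

lemma layer_root: "layer D (root D) = 1"
  using first_layer by auto

lemma layer_terminal: "layer D (terminal D) = n + 1"
  using last_layer by auto

lemma rt_path_length: "rt_path D p \<Longrightarrow> length p = n"
  using awalk_layers(1)[OF rt_path_awalk] layer_terminal layer_root by simp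

lemma rt_path_tail_layer:
  "rt_path D p \<Longrightarrow> i < n \<Longrightarrow> tail_layer D (p ! i) = i + 1"
  using awalk_layers(2)[OF rt_path_awalk] rt_path_length layer_root by simp

lemma rt_path_distinct:
  assumes "rt_path D p"
  shows "distinct p"
  unfolding distinct_conv_nth using rt_path_tail_layer[OF assms] rt_path_length[OF assms]
  by (metis add_right_cancel)

text \<open>The \<open>i\<close>-th arc of a path is its only arc that leaves layer \<open>i + 1\<close>, so the arc set
  determines the order of the arcs.\<close>

lemma rt_path_determined_by_arcs:
  assumes p: "rt_path D p" and q: "rt_path D q" and "set p = set q"
  shows "p = q"
proof (rule nth_equalityI)
  show "length p = length q" using rt_path_length p q by simp
  fix i assume "i < length p"
  then have i: "i < n" using rt_path_length p by simp
  then have "p ! i \<in> set q" using assms rt_path_length by (metis nth_mem)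
  then obtain j where "j < n" "q ! j = p ! i"
    using rt_path_length[OF q] by (auto simp: in_set_conv_nth)
  with i have "j = i"
    using rt_path_tail_layer[OF p] rt_path_tail_layer[OF q] by (metis add_right_cancel)
  with \<open>q ! j = p ! i\<close> show "p ! i = q ! i" by simp
qed

lemma tail_layer_range:
  assumes "a \<in> arcs (dgraph D)"
  shows "tail_layer D a \<in> {1..n}"
  using arc_layer[OF assms] layer_range[OF G.tail_in_verts[OF assms]]
    layer_range[OF G.head_in_verts[OF assms]]
  by (auto simp: tail_layer_def)

lemma incidence_support:
  "rt_path D p \<Longrightarrow> {a \<in> arcs (dgraph D). incidence D p a = 1} = set p"
  using rt_path_arcs by (auto simp: incidence_def split: if_splits)

lemma bij_betw_incidence: "bij_betw (incidence D) {p. rt_path D p} (path_vectors D)"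
proof (intro bij_betw_imageI inj_onI equalityI subsetI)
  fix p q assume "p \<in> {p. rt_path D p}" "q \<in> {p. rt_path D p}" "incidence D p = incidence D q"
  then show "p = q"
    using incidence_support[of p] incidence_support[of q] rt_path_determined_by_arcs by auto
next
  fix y assume "y \<in> incidence D ` {p. rt_path D p}"
  then obtain p where p: "rt_path D p" "y = incidence D p" by auto
  moreover have "incidence D p \<in> arcs (dgraph D) \<rightarrow>\<^sub>E {0, 1}"
    by (simp add: incidence_def)
  ultimately show "y \<in> path_vectors D"
    unfolding path_vectors_def using incidence_support[OF p(1)] by blast
next
  fix y assume "y \<in> path_vectors D"
  then obtain p where y: "y \<in> arcs (dgraph D) \<rightarrow>\<^sub>E {0, 1}" and p: "rt_path D p"
    and supp: "set p = {a \<in> arcs (dgraph D). y a = 1}"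
    by (auto simp: path_vectors_def)
  have "y = incidence D p"
  proof
    fix a show "y a = incidence D p a"
    proof (cases "a \<in> arcs (dgraph D)")
      case True
      then have "y a = 0 \<or> y a = 1" using PiE_mem[OF y] by blast
      with True show ?thesis by (auto simp: incidence_def supp)
    next
      case False
      then show ?thesis using PiE_arb[OF y] by (simp add: incidence_def)
    qed
  qed
  with p show "y \<in> incidence D ` {p. rt_path D p}" by blast
qed

lemma sum_incidence:
  assumes "rt_path D p"
  shows "(\<Sum>a\<in>arcs (dgraph D). len D a * incidence D p a) = (\<Sum>a\<leftarrow>p. len D a)"
proof -
  have "(\<Sum>a\<in>arcs (dgraph D). len D a * incidence D p a)
      = (\<Sum>a\<in>arcs (dgraph D). if a \<in> set p then len D a else 0)"
    by (intro sum.cong) (auto simp: incidence_def)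
  also have "\<dots> = (\<Sum>a\<in>set p. len D a)"
    using rt_path_arcs[OF assms] by (simp add: sum.If_cases Int_absorb1)
  also have "\<dots> = (\<Sum>a\<leftarrow>p. len D a)"
    using rt_path_distinct[OF assms] by (simp add: sum_list_distinct_conv_sum_set)
  finally show ?thesis .
qed


section \<open>Admissible paths\<close>

lemma binary_blocking_cases:
  assumes "xL \<in> binary_vecs n" and "a \<in> arcs (dgraph D)"
  shows "xL $ (tail_layer D a - 1) = 0 \<or> xL $ (tail_layer D a - 1) = 1"
proof -
  have "tail_layer D a - 1 < n" using tail_layer_range[OF assms(2)] by auto
  then show ?thesis using assms(1) unfolding binary_vecs_def by blast
qed

text \<open>On an arc off the path, the bound reads \<open>0 \<le> 1 - x\<^sup>L\<^sub>j\<close> and holds; on an arc of the path it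
  forces \<open>x\<^sup>L\<^sub>j = 0\<close>.\<close>

lemma interdicted_incidence_iff:
  assumes "xL \<in> binary_vecs n" and p: "rt_path D p"
  shows "incidence D p \<in> interdicted_paths D xL \<longleftrightarrow> admissible D xL p"
proof -
  have "incidence D p \<in> path_vectors D"
    using bij_betw_incidence p by (auto simp: bij_betw_def)
  moreover have "incidence D p a \<le> 1 - real_of_int (xL $ (tail_layer D a - 1)) \<longleftrightarrow>
      (a \<in> set p \<longrightarrow> xL $ (tail_layer D a - 1) = 0)" if "a \<in> arcs (dgraph D)" for a
    using binary_blocking_cases[OF assms(1) that] that by (auto simp: incidence_def)
  ultimately show ?thesis
    using p rt_path_arcs[OF p] by (auto simp: interdicted_paths_def admissible_def)
qed

lemma path_solution_nth:
  "rt_path D p \<Longrightarrow> i < n \<Longrightarrow> path_solution D p $ i = val D (p ! i)"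
  by (simp add: path_solution_def vec_of_list_index rt_path_length)

text \<open>Layers count from 1 and vector components from 0, so the \<open>i\<close>-th component of the solution
  comes from the arc that leaves layer \<open>i + 1\<close>, the layer that component \<open>i\<close> of \<open>xL\<close> controls.\<close>

lemma follower_feasible_path_solution_iff:
  assumes xL: "xL \<in> binary_vecs n" and p: "rt_path D p"
    and x: "path_solution D p \<in> feasible_set n AF bF"
  shows "follower_feasible n AF bF xL (path_solution D p) \<longleftrightarrow> admissible D xL p"
proof -
  have len: "length p = n" using rt_path_length p .
  have bin: "path_solution D p \<in> binary_vecs n" using x by (simp add: feasible_set_def)
  have "val D (p ! i) \<le> 1 - xL $ i \<longleftrightarrow> (val D (p ! i) = 1 \<longrightarrow> xL $ i = 0)" if "i < n" for i
  proof -
    have "val D (p ! i) \<in> {0, 1}" "xL $ i \<in> {0, 1}"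
      using bin xL that path_solution_nth[OF p that] by (auto simp: binary_vecs_def)
    then show ?thesis by auto
  qed
  then have "path_solution D p \<le> vec n (\<lambda>_. 1) - xL \<longleftrightarrow>
      (\<forall>i<n. val D (p ! i) = 1 \<longrightarrow> xL $ i = 0)"
    using bin xL path_solution_nth[OF p] by (auto simp: less_eq_vec_def binary_vecs_def)
  also have "\<dots> \<longleftrightarrow> (\<forall>a\<in>set p. val D a = 1 \<longrightarrow> xL $ (tail_layer D a - 1) = 0)"
    using rt_path_tail_layer[OF p] len by (auto simp: all_set_conv_all_nth)
  finally show ?thesis
    using p x by (auto simp: follower_feasible_def feasible_set_def admissible_def)
qed


section \<open>The two optimization problems\<close>

lemma bij_betw_follower_optimal:
  assumes enc: "encodes D (feasible_set n AF bF) (\<lambda>x. cF \<bullet> rvec x)"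
    and xL: "xL \<in> binary_vecs n"
  shows "bij_betw (path_solution D)
    {p. is_arg_max (\<lambda>p. \<Sum>a\<leftarrow>p. len D a) (\<lambda>p. p \<in> {p. admissible D xL p}) p}
    {xF. follower_optimal n AF bF cF xL xF}"
proof -
  have bij: "bij_betw (path_solution D) {p. rt_path D p} (feasible_set n AF bF)"
    using enc by (simp add: encodes_def)
  have mem: "path_solution D p \<in> feasible_set n AF bF" if "rt_path D p" for p
    using bij that by (auto simp: bij_betw_def)
  have "bij_betw (path_solution D) {p. admissible D xL p} {x. follower_feasible n AF bF xL x}"
  proof (rule bij_betw_restrict[OF bij])
    show "{x. follower_feasible n AF bF xL x} \<subseteq> feasible_set n AF bF"
      by (auto simp: follower_feasible_def feasible_set_def)
  qed (use follower_feasible_path_solution_iff[OF xL] mem in \<open>auto simp: admissible_def\<close>)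
  from bij_betw_arg_max[OF this, of "\<lambda>x. cF \<bullet> rvec x" "\<lambda>p. \<Sum>a\<leftarrow>p. len D a"]
  show ?thesis using enc by (simp add: follower_optimal_def encodes_def admissible_def)
qed

lemma bij_betw_optimal_paths:
  assumes xL: "xL \<in> binary_vecs n"
  shows "bij_betw (incidence D)
    {p. is_arg_max (\<lambda>p. \<Sum>a\<leftarrow>p. len D a) (\<lambda>p. p \<in> {p. admissible D xL p}) p}
    (optimal_paths D (interdicted_paths D xL))"
proof -
  have "bij_betw (incidence D) {p. admissible D xL p} (interdicted_paths D xL)"
    by (rule bij_betw_restrict[OF bij_betw_incidence])
      (use interdicted_incidence_iff[OF xL] in \<open>auto simp: admissible_def interdicted_paths_def\<close>)
  from bij_betw_arg_max[OF this, of "\<lambda>y. \<Sum>a\<in>arcs (dgraph D). len D a * y a"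
      "\<lambda>p. \<Sum>a\<leftarrow>p. len D a"]
  show ?thesis using sum_incidence by (simp add: optimal_paths_def admissible_def)
qed

text \<open>A row of an arc of value 1 is the bound on that arc, and any other row reads \<open>0 \<le> 0\<close>;
  so every \<open>R\<close> between the arcs of value 1 and all arcs gives the same set.\<close>

lemma constrained_paths_side_matrix:
  assumes "{a \<in> arcs (dgraph D). val D a = 1} \<subseteq> R" and "R \<subseteq> arcs (dgraph D)"
  shows "constrained_paths D R (side_matrix D) (side_rhs D xL) = interdicted_paths D xL"
proof -
  have "(\<Sum>a\<in>arcs (dgraph D). side_matrix D i a * y a) = (if val D i = 1 then y i else 0)"
    if "i \<in> R" for i and y :: "_ \<Rightarrow> real"
  proof -
    have "(\<Sum>a\<in>arcs (dgraph D). side_matrix D i a * y a)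
        = (\<Sum>a\<in>arcs (dgraph D). if i = a then (if val D i = 1 then y i else 0) else 0)"
      by (intro sum.cong) (auto simp: side_matrix_def)
    then show ?thesis using that assms(2) by auto
  qed
  then show ?thesis
    using assms by (auto simp: constrained_paths_def interdicted_paths_def side_rhs_def)
qed

lemma card_arcs_mono: "R \<subseteq> arcs (dgraph D) \<Longrightarrow> card R \<le> card (arcs (dgraph D))"
  by (simp add: card_mono)

end

theorem proposition3:
  fixes n mL mF :: nat
    and AL BL AF :: "real mat" and bL bF cF :: "real vec"
    and D :: "('v, 'a) dd" and xL :: "int vec"
  assumes "AL \<in> carrier_mat mL n" and "BL \<in> carrier_mat mL n" and "bL \<in> carrier_vec mL"
    and "AF \<in> carrier_mat mF n" and "bF \<in> carrier_vec mF" and "cF \<in> carrier_vec n"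
    and "decision_diagram n D"
    and "encodes D (feasible_set n AF bF) (\<lambda>x. cF \<bullet> rvec x)"
    and "\<forall>a\<in>arcs (dgraph D). len D a = (if val D a = 1 then cF $ (tail_layer D a - 1) else 0)"
    and "relatively_complete_recourse n AL BL bL AF bF"
    and "leader_feasible n AL BL bL xL"
  shows "(\<exists>\<phi>. bij_betw \<phi> {xF. follower_optimal n AF bF cF xL xF}
                (optimal_paths D (interdicted_paths D xL))) \<and>
    (\<forall>R. {a \<in> arcs (dgraph D). val D a = 1} \<subseteq> R \<and> R \<subseteq> arcs (dgraph D) \<longrightarrow>
       card R \<le> card (arcs (dgraph D)) \<and>
       constrained_paths D R (side_matrix D) (side_rhs D xL) = interdicted_paths D xL)"
proof -
  interpret decision_diagram n D by fact
  have xL: "xL \<in> binary_vecs n" using assms(11) by (simp add: leader_feasible_def)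
  show ?thesis
    using bij_betw_trans[OF bij_betw_inv_into[OF bij_betw_follower_optimal[OF assms(8) xL]]
        bij_betw_optimal_paths[OF xL]]
      constrained_paths_side_matrix card_arcs_mono by blast
qed

end
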